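(* The insertion-elimination algebra $\mathfrak{g}$ is not finitely generated as a Lie algebra.
   Context: A rooted tree is a finite connected undirected cycle-free graph $t$ with a distinguished vertex $\mathrm{rt}(t)$, its root. Rooted trees are considered up to (root-preserving graph) isomorphism; equality of rooted trees means isomorphism, and $\mathbb{T}$ is the set of all isomorphism classes of rooted trees. $V(t)$ and $E(t)$ are the sets of vertices and edges of $t$, and $|t|$ is the cardinality of $V(t)$. For $e\in E(t)$, removing $e$ divides $t$ into two rooted subtrees: $R_e(t)$ is the one containing $\mathrm{rt}(t)$, and $P_e(t)$ is the other one; a subtree is rooted at its vertex at minimal distance in $t$ from $\mathrm{rt}(t)$. For $s,t\in\mathbb{T}$ and $v\in V(s)$, $s\cup_v t$ is the rooted tree obtained by joining the root of $t$ to $s$ at $v$ by a single new edge, with root $\mathrm{rt}(s)$. For $t_1,t_2,t_3\in\mathbb{T}$ put $$\alpha(t_1,t_2,t_3)=|\{e\in E(t_2)\mid R_e(t_2)=t_3,\ P_e(t_2)=t_1\}|,\qquad \beta(t_1,t_2,t_3)=|\{v\in V(t_3)\mid t_1=t_3\cup_v t_2\}|.$$ The insertion-elimination algebra $\mathfrak{g}$ is the Lie algebra over $\mathbb{C}$ with basis $\{d\}\cup\{D_t^{+},D_t^-\mid t\in\mathbb{T}\}$ and relations, for $s,t\in\mathbb{T}$: $[D_s^+,D_t^+]=\sum_{r\in\mathbb{T}}(\beta(r,s,t)-\beta(r,t,s))D_r^+$; $[D_s^-,D_t^-]=\sum_{r\in\mathbb{T}}(\alpha(t,r,s)-\alpha(s,r,t))D_r^-$;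 $[D_s^-,D_t^+]=\sum_{r\in\mathbb{T}}\alpha(s,t,r)D_r^++\sum_{r\in\mathbb{T}}\beta(s,t,r)D_r^-$ for $s\neq t$; $[D_t^-,D_t^+]=d$; $[d,D_t^-]=-|t|D_t^-$; $[d,D_t^+]=|t|D_t^+$. *)

theory Defs
  imports Complex_Main "HOL-Library.Groups_Big_Fun"
begin

section \<open>Rooted trees\<close>

datatype 'a rgraph = RGraph (verts: "'a set") (edges: "'a set set") (root: 'a)

definition adj :: "'a set set \<Rightarrow> ('a \<times> 'a) set" where
  "adj E = {(u, v). {u, v} \<in> E}"

definition is_cycle :: "'a set set \<Rightarrow> 'a list \<Rightarrow> bool" where
  "is_cycle E xs \<longleftrightarrow> length xs \<ge> 3 \<and> distinct xs \<and>
     (\<forall>i < length xs. {xs ! i, xs ! (Suc i mod length xs)} \<in> E)"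

definition rooted_tree :: "'a rgraph \<Rightarrow> bool" where
  "rooted_tree g \<longleftrightarrow>
     finite (verts g) \<and> root g \<in> verts g \<and>
     (\<forall>e \<in> edges g. \<exists>u v. u \<in> verts g \<and> v \<in> verts g \<and> u \<noteq> v \<and> e = {u, v}) \<and>
     (\<forall>u \<in> verts g. \<forall>v \<in> verts g. (u, v) \<in> (adj (edges g))\<^sup>*) \<and>
     (\<nexists>xs. is_cycle (edges g) xs)"

definition iso_via :: "('a \<Rightarrow> 'b) \<Rightarrow> 'a rgraph \<Rightarrow> 'b rgraph \<Rightarrow> bool" where
  "iso_via f g h \<longleftrightarrow> bij_betw f (verts g) (verts h) \<and> edges h = (\<lambda>e. f ` e) ` edges g \<and>
     root h = f (root g)"

definition rg_iso :: "'a rgraph \<Rightarrow> 'b rgraph \<Rightarrow> bool" where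
  "rg_iso g h \<longleftrightarrow> (\<exists>f. iso_via f g h)"

definition gdist :: "'a rgraph \<Rightarrow> 'a \<Rightarrow> 'a \<Rightarrow> nat" where
  "gdist g u v = (LEAST n. (u, v) \<in> adj (edges g) ^^ n)"

definition root_part :: "'a rgraph \<Rightarrow> 'a set \<Rightarrow> 'a set" where
  "root_part g e = {v \<in> verts g. (root g, v) \<in> (adj (edges g - {e}))\<^sup>*}"

definition tree_R :: "'a rgraph \<Rightarrow> 'a set \<Rightarrow> 'a rgraph" where
  "tree_R g e = RGraph (root_part g e) {f \<in> edges g - {e}. f \<subseteq> root_part g e} (root g)"

definition tree_P :: "'a rgraph \<Rightarrow> 'a set \<Rightarrow> 'a rgraph" where
  "tree_P g e = (let W = verts g - root_part g e in
     RGraph W {f \<in> edges g - {e}. f \<subseteq> W} (ARG_MIN (gdist g (root g)) v. v \<in> W))"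

definition tree_join :: "'a rgraph \<Rightarrow> 'a \<Rightarrow> 'b rgraph \<Rightarrow> ('a + 'b) rgraph" where
  "tree_join s v t = RGraph (verts s <+> verts t)
     (image Inl ` edges s \<union> image Inr ` edges t \<union> {{Inl v, Inr (root t)}}) (Inl (root s))"

subsection \<open>Invariance under isomorphism\<close>

lemma rooted_tree_edge:
  assumes "rooted_tree g" "e \<in> edges g"
  obtains u v where "u \<in> verts g" "v \<in> verts g" "u \<noteq> v" "e = {u, v}"
  using assms unfolding rooted_tree_def by blast

lemma rooted_tree_edges_sub: "rooted_tree g \<Longrightarrow> e \<in> edges g \<Longrightarrow> e \<subseteq> verts g"
  by (auto elim: rooted_tree_edge)

lemma rg_iso_refl: "rg_iso g g"
  unfolding rg_iso_def iso_via_def by (rule exI[of _ id]) auto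

lemma rg_iso_trans: assumes "rg_iso g h" "rg_iso h k" shows "rg_iso g k"
proof -
  from assms obtain f f' where "iso_via f g h" "iso_via f' h k" by (auto simp: rg_iso_def)
  then have "iso_via (f' \<circ> f) g k"
    by (auto simp: iso_via_def image_image image_comp intro: bij_betw_trans)
  then show ?thesis by (auto simp: rg_iso_def)
qed

lemma inv_image_edges:
  assumes "inj_on f V" "\<And>e. e \<in> F \<Longrightarrow> e \<subseteq> V"
  shows "(\<lambda>e. inv_into V f ` e) ` (\<lambda>e. f ` e) ` F = F"
proof -
  have "(\<lambda>e. inv_into V f ` e) ` (\<lambda>e. f ` e) ` F = (\<lambda>e. inv_into V f ` (f ` e)) ` F"
    by (rule image_image)
  also have "\<dots> = (\<lambda>e. e) ` F"
    using assms by (intro image_cong refl inv_into_image_cancel) auto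
  finally show ?thesis by simp
qed

lemma iso_via_inv:
  assumes "iso_via f g h" "\<And>e. e \<in> edges g \<Longrightarrow> e \<subseteq> verts g" "root g \<in> verts g"
  shows "iso_via (inv_into (verts g) f) h g"
proof -
  have b: "bij_betw f (verts g) (verts h)" using assms(1) by (simp add: iso_via_def)
  then have i: "inj_on f (verts g)" by (simp add: bij_betw_def)
  show ?thesis using assms b i inv_image_edges[OF i, of "edges g"]
    by (simp add: iso_via_def bij_betw_inv_into)
qed

lemma rg_iso_sym:
  assumes "rg_iso g h" "\<And>e. e \<in> edges g \<Longrightarrow> e \<subseteq> verts g" "root g \<in> verts g"
  shows "rg_iso h g"
  using assms iso_via_inv unfolding rg_iso_def by blast

lemma adj_relpow_map:
  "(u, v) \<in> adj E ^^ n \<Longrightarrow> (f u, f v) \<in> adj ((\<lambda>e. f ` e) ` E) ^^ n"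
proof (induction n arbitrary: v)
  case (Suc n)
  then obtain w where w: "(u, w) \<in> adj E ^^ n" "{w, v} \<in> E" by (auto simp: adj_def)
  then have "{f w, f v} \<in> (\<lambda>e. f ` e) ` E" by (auto simp: image_iff intro!: bexI[of _ "{w,v}"])
  then show ?case using Suc.IH[OF w(1)] by (auto simp: adj_def)
qed simp

lemma iso_edge_bij:
  assumes "iso_via f g h" "rooted_tree g"
  shows "bij_betw (\<lambda>e. f ` e) (edges g) (edges h)"
proof -
  have "inj_on f (verts g)" using assms by (simp add: iso_via_def bij_betw_def)
  then have "inj_on (\<lambda>e. f ` e) (edges g)"
    using rooted_tree_edges_sub[OF assms(2)] by (intro inj_onI) (simp add: inj_on_image_eq_iff)
  then show ?thesis using assms by (simp add: iso_via_def bij_betw_def)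
qed

lemma iso_relpow:
  assumes fgh: "iso_via f g h" and g: "rooted_tree g" and F: "F \<subseteq> edges g"
    and uv: "u \<in> verts g" "v \<in> verts g"
  shows "(f u, f v) \<in> adj ((\<lambda>e. f ` e) ` F) ^^ n \<longleftrightarrow> (u, v) \<in> adj F ^^ n"
proof
  let ?g = "inv_into (verts g) f"
  have i: "inj_on f (verts g)" using fgh by (simp add: iso_via_def bij_betw_def)
  have "(\<lambda>e. ?g ` e) ` (\<lambda>e. f ` e) ` F = F"
    using F rooted_tree_edges_sub[OF g] by (intro inv_image_edges[OF i]) auto
  moreover assume "(f u, f v) \<in> adj ((\<lambda>e. f ` e) ` F) ^^ n"
  ultimately show "(u, v) \<in> adj F ^^ n"
    using adj_relpow_map[of "f u" "f v" n "(\<lambda>e. f ` e) ` F" ?g] i uv by simp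
qed (rule adj_relpow_map)

lemma iso_edges_diff:
  assumes "iso_via f g h" "rooted_tree g" "e \<in> edges g"
  shows "edges h - {f ` e} = (\<lambda>e. f ` e) ` (edges g - {e})"
  using iso_edge_bij[OF assms(1,2)] assms(3)
    inj_on_image_set_diff[of "\<lambda>e. f ` e" "edges g" "edges g" "{e}"]
  by (simp add: bij_betw_def)

lemma iso_root_part:
  assumes "iso_via f g h" "rooted_tree g" "e \<in> edges g"
  shows "root_part h (f ` e) = f ` root_part g e"
proof -
  have r: "root g \<in> verts g" using assms(2) by (simp add: rooted_tree_def)
  have reach: "(f (root g), f v) \<in> (adj (edges h - {f ` e}))\<^sup>* \<longleftrightarrow> (root g, v) \<in> (adj (edges g - {e}))\<^sup>*"
    if "v \<in> verts g" for v
    using iso_relpow[OF assms(1,2) Diff_subset r that]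
    unfolding iso_edges_diff[OF assms] rtrancl_power by simp
  have vr: "verts h = f ` verts g" "root h = f (root g)"
    using assms(1) by (auto simp: iso_via_def bij_betw_def)
  have image: "{w \<in> f ` V. P w} = f ` {v \<in> V. Q v}" if "\<And>v. v \<in> V \<Longrightarrow> P (f v) \<longleftrightarrow> Q v" for V P Q
    using that by auto
  show ?thesis unfolding root_part_def vr by (rule image) (rule reach)
qed

lemma image_sub_iff: "inj_on f V \<Longrightarrow> A \<subseteq> V \<Longrightarrow> B \<subseteq> V \<Longrightarrow> f ` A \<subseteq> f ` B \<longleftrightarrow> A \<subseteq> B"
  by (blast dest: inj_onD)

lemma iso_tree_R:
  assumes "iso_via f g h" "rooted_tree g" "e \<in> edges g"
  shows "iso_via f (tree_R g e) (tree_R h (f ` e))"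
proof -
  have i: "inj_on f (verts g)" using assms by (simp add: iso_via_def bij_betw_def)
  have s: "root_part g e \<subseteq> verts g" by (auto simp: root_part_def)
  have sub: "f ` k \<subseteq> f ` root_part g e \<longleftrightarrow> k \<subseteq> root_part g e" if "k \<in> edges g" for k
    using image_sub_iff[OF i rooted_tree_edges_sub[OF assms(2) that] s] .
  have "{k \<in> edges h - {f ` e}. k \<subseteq> f ` root_part g e} = (\<lambda>e. f ` e) ` {k \<in> edges g - {e}. k \<subseteq> root_part g e}"
    unfolding iso_edges_diff[OF assms] using sub by blast
  then show ?thesis using assms(1) inj_on_subset[OF i s]
    by (auto simp: iso_via_def tree_R_def iso_root_part[OF assms] bij_betw_def)
qed

lemma rooted_tree_cut_nonempty:
  assumes g: "rooted_tree g" and e: "e \<in> edges g"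
  obtains v where "v \<in> verts g" "v \<notin> root_part g e"
proof -
  let ?E = "edges g - {e}"
  obtain a b where ab: "a \<in> verts g" "b \<in> verts g" "a \<noteq> b" "e = {a, b}"
    using rooted_tree_edge[OF g e] .
  have "\<not> (a \<in> root_part g e \<and> b \<in> root_part g e)"
  proof
    assume *: "a \<in> root_part g e \<and> b \<in> root_part g e"
    have "sym ((adj ?E)\<^sup>*)"
      by (intro sym_rtrancl) (auto simp: sym_def adj_def insert_commute)
    moreover have "(root g, a) \<in> (adj ?E)\<^sup>*" "(root g, b) \<in> (adj ?E)\<^sup>*"
      using * by (simp_all add: root_part_def)
    ultimately have "(a, b) \<in> (adj ?E)\<^sup>*"
      by (meson rtrancl_trans symD)
    then obtain m where "(a, b) \<in> adj ?E ^^ m" using rtrancl_power by blast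
    define n where "n = (LEAST n. (a, b) \<in> adj ?E ^^ n)"
    have n: "(a, b) \<in> adj ?E ^^ n" "\<And>k. (a, b) \<in> adj ?E ^^ k \<Longrightarrow> n \<le> k"
      unfolding n_def by (rule LeastI, fact) (rule Least_le)
    from n(1) obtain p where p: "p 0 = a" "p n = b" "\<And>i. i < n \<Longrightarrow> (p i, p (Suc i)) \<in> adj ?E"
      unfolding relpow_fun_conv by blast
    have seg: "i \<le> j \<Longrightarrow> j \<le> n \<Longrightarrow> (p i, p j) \<in> adj ?E ^^ (j - i)" for i j
      unfolding relpow_fun_conv using p(3) by (intro exI[of _ "\<lambda>k. p (i + k)"]) auto
    have inj: "p i \<noteq> p j" if "i < j" "j \<le> n" for i j
    proof
      assume "p i = p j"
      then have "(a, b) \<in> adj ?E ^^ (i + (n - j))"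
        using seg[of 0 i] seg[of j n] that p unfolding relpow_add by auto
      then show False using n(2) that by fastforce
    qed
    have n2: "n \<ge> 2"
    proof (rule ccontr)
      assume "\<not> n \<ge> 2"
      then have "n = 0 \<or> n = 1" by linarith
      then show False using p(1,2) p(3)[of 0] ab by (auto simp: adj_def)
    qed
    let ?xs = "map p [0..<Suc n]"
    have "is_cycle (edges g) ?xs"
      unfolding is_cycle_def
    proof (intro conjI allI impI)
      show "distinct ?xs" unfolding distinct_map
        using inj by (auto simp: inj_on_def simp del: upt_Suc) (metis less_Suc_eq_le linorder_neqE_nat)
      fix i assume "i < length ?xs"
      then have "i \<le> n" by simp
      show "{?xs ! i, ?xs ! (Suc i mod length ?xs)} \<in> edges g"
      proof (cases "i = n")
        case True
        then show ?thesis using p e ab by (simp add: insert_commute del: upt_Suc)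
      next
        case False
        then show ?thesis using p(3)[of i] \<open>i \<le> n\<close> by (simp add: adj_def del: upt_Suc)
      qed
    qed (use n2 in simp)
    then show False using g by (simp add: rooted_tree_def)
  qed
  then show ?thesis using that ab by blast
qed

text \<open>The component cut off by \<open>e\<close> has a unique vertex nearest to the root, the endpoint of \<open>e\<close>.\<close>

lemma rooted_tree_cut_root:
  assumes g: "rooted_tree g" and e: "e \<in> edges g"
  obtains b where "b \<in> verts g - root_part g e"
    "\<And>w. w \<in> verts g - root_part g e \<Longrightarrow> w \<noteq> b \<Longrightarrow> gdist g (root g) b < gdist g (root g) w"
proof -
  let ?W = "verts g - root_part g e"
  let ?A = "adj (edges g)"
  let ?r = "root g"
  have rR: "?r \<in> root_part g e" using g by (auto simp: root_part_def rooted_tree_def)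
  have cross: "{u, v} = e" if "(u, v) \<in> ?A" "u \<in> root_part g e" "v \<notin> root_part g e" for u v
  proof (rule ccontr)
    assume "{u, v} \<noteq> e"
    then have "(u, v) \<in> adj (edges g - {e})" using that by (auto simp: adj_def)
    then have "(?r, v) \<in> (adj (edges g - {e}))\<^sup>*"
      using that(2) unfolding root_part_def by (auto intro: rtrancl_into_rtrancl)
    moreover have "v \<in> verts g" using that(1) rooted_tree_edges_sub[OF g] by (auto simp: adj_def)
    ultimately show False using that(3) by (auto simp: root_part_def)
  qed
  have le: "gdist g ?r v \<le> n" if "(?r, v) \<in> ?A ^^ n" for v n
    unfolding gdist_def using that by (rule Least_le)
  have key: "\<exists>b \<in> ?W. b \<in> e \<and> (\<exists>a \<in> root_part g e. a \<in> e) \<and> gdist g ?r b \<le> n \<and> (w \<noteq> b \<longrightarrow> gdist g ?r b < n)"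
    if "(?r, w) \<in> ?A ^^ n" "w \<in> ?W" for w n
    using that
  proof (induction n arbitrary: w)
    case 0 then show ?case using rR by auto
  next
    case (Suc n)
    then obtain u where u: "(?r, u) \<in> ?A ^^ n" "(u, w) \<in> ?A" by auto
    have uv: "u \<in> verts g" using u(2) rooted_tree_edges_sub[OF g] by (auto simp: adj_def)
    show ?case
    proof (cases "u \<in> root_part g e")
      case True
      then have "{u, w} = e" using cross u(2) Suc.prems(2) by auto
      then show ?thesis using Suc.prems True le[OF Suc.prems(1)] by (intro bexI[of _ w]) auto
    next
      case False
      with Suc.IH[OF u(1)] uv obtain b where "b \<in> ?W" "b \<in> e" "\<exists>a \<in> root_part g e. a \<in> e" "gdist g ?r b \<le> n"
        by blast
      then show ?thesis by (intro bexI[of _ b]) auto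
    qed
  qed
  have reach: "(?r, w) \<in> ?A ^^ gdist g ?r w" if "w \<in> verts g" for w
  proof -
    have "(?r, w) \<in> ?A\<^sup>*" using g that by (auto simp: rooted_tree_def)
    then obtain m where "(?r, w) \<in> ?A ^^ m" using rtrancl_power by blast
    then show ?thesis unfolding gdist_def by (rule LeastI)
  qed
  obtain w0 where w0: "w0 \<in> ?W" using rooted_tree_cut_nonempty[OF g e] by blast
  obtain b a where b: "b \<in> ?W" "b \<in> e" "a \<in> root_part g e" "a \<in> e"
    using key[OF reach w0] w0 by blast
  have uniq: "c = b" if "c \<in> ?W" "c \<in> e" for c
    by (rule rooted_tree_edge[OF g e]) (use that b in auto)
  show ?thesis
  proof (rule that[OF b(1)])
    fix w assume w: "w \<in> ?W" "w \<noteq> b"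
    then obtain c where "c \<in> ?W" "c \<in> e" "w \<noteq> c \<longrightarrow> gdist g ?r c < gdist g ?r w"
      using key[OF reach[of w] w(1)] by blast
    then show "gdist g ?r b < gdist g ?r w" using uniq w by blast
  qed
qed

lemma iso_tree_P:
  assumes "iso_via f g h" "rooted_tree g" "rooted_tree h" "e \<in> edges g"
  shows "iso_via f (tree_P g e) (tree_P h (f ` e))"
    and "root (tree_P g e) \<in> verts (tree_P g e)"
proof -
  note a = assms(1,2,4)
  let ?W = "verts g - root_part g e"
  have i: "inj_on f (verts g)" and hv: "verts h = f ` verts g" and hr: "root h = f (root g)"
    using assms by (auto simp: iso_via_def bij_betw_def)
  have he: "edges h = (\<lambda>e. f ` e) ` edges g" using assms by (simp add: iso_via_def)
  have W: "verts h - root_part h (f ` e) = f ` ?W"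
    unfolding iso_root_part[OF a] hv
    by (intro inj_on_image_set_diff[OF i, symmetric]) (auto simp: root_part_def)
  have d: "gdist h (root h) (f v) = gdist g (root g) v" if "v \<in> verts g" for v
    unfolding gdist_def hr he using iso_relpow[OF a(1,2) order_refl _ that, of "root g"] a(2)
    by (simp add: rooted_tree_def)
  obtain b where b: "b \<in> ?W"
    "\<And>w. w \<in> ?W \<Longrightarrow> w \<noteq> b \<Longrightarrow> gdist g (root g) b < gdist g (root g) w"
    using rooted_tree_cut_root[OF assms(2,4)] by blast
  have arg: "(ARG_MIN m v. v \<in> S) = c"
    if "c \<in> S" "\<And>w. w \<in> S \<Longrightarrow> w \<noteq> c \<Longrightarrow> m c < m w" for m :: "'c \<Rightarrow> nat" and S c
    using arg_min_nat_lemma[of "\<lambda>v. v \<in> S" c m] that by force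
  have r1: "(ARG_MIN (gdist g (root g)) v. v \<in> ?W) = b"
    by (rule arg) (use b in auto)
  have r2: "(ARG_MIN (gdist h (root h)) v. v \<in> f ` ?W) = f b"
    using arg_min_nat_lemma[of "\<lambda>v. v \<in> f ` ?W" "f b" "gdist h (root h)"] b d
    by (smt (verit, best) DiffD1 imageE image_eqI linorder_not_less)
  show "root (tree_P g e) \<in> verts (tree_P g e)"
    using r1 b by (simp add: tree_P_def Let_def)
  have s: "?W \<subseteq> verts g" by auto
  have sub: "f ` k \<subseteq> f ` ?W \<longleftrightarrow> k \<subseteq> ?W" if "k \<in> edges g" for k
    using image_sub_iff[OF i rooted_tree_edges_sub[OF assms(2) that] s] .
  have "{k \<in> edges h - {f ` e}. k \<subseteq> f ` ?W} = (\<lambda>e. f ` e) ` {k \<in> edges g - {e}. k \<subseteq> ?W}"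
    unfolding iso_edges_diff[OF a] using sub by blast
  then show "iso_via f (tree_P g e) (tree_P h (f ` e))"
    using r1 r2 inj_on_subset[OF i s] by (simp add: iso_via_def tree_P_def Let_def W bij_betw_def)
qed

lemma iso_tree_join:
  assumes "iso_via f s s'" "iso_via k t t'"
  shows "iso_via (map_sum f k) (tree_join s v t) (tree_join s' (f v) t')"
proof -
  let ?m = "map_sum f k"
  have f: "inj_on f (verts s)" "verts s' = f ` verts s" "edges s' = (\<lambda>e. f ` e) ` edges s"
      "root s' = f (root s)"
    and k: "inj_on k (verts t)" "verts t' = k ` verts t" "edges t' = (\<lambda>e. k ` e) ` edges t"
      "root t' = k (root t)"
    using assms by (auto simp: iso_via_def bij_betw_def)
  have "inj_on ?m (verts s <+> verts t)"
  proof (rule inj_onI)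
    fix x y assume "x \<in> verts s <+> verts t" "y \<in> verts s <+> verts t" "?m x = ?m y"
    then show "x = y" using inj_onD[OF f(1)] inj_onD[OF k(1)] by (cases x; cases y) auto
  qed
  moreover have "?m ` (verts s <+> verts t) = verts s' <+> verts t'"
    by (simp add: Plus_def image_Un image_image f(2) k(2))
  moreover have "(\<lambda>e. ?m ` e) ` (image Inl ` edges s \<union> image Inr ` edges t \<union> {{Inl v, Inr (root t)}})
      = image Inl ` edges s' \<union> image Inr ` edges t' \<union> {{Inl (f v), Inr (root t')}}"
    by (simp add: image_Un image_image f(3) k(3,4))
  ultimately show ?thesis
    by (simp only: iso_via_def tree_join_def rgraph.sel bij_betw_def f(4) map_sum.simps simp_thms)
qed

definition ends_ok :: "'a rgraph \<Rightarrow> bool" where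
  "ends_ok g \<longleftrightarrow> (\<forall>e \<in> edges g. e \<subseteq> verts g) \<and> root g \<in> verts g"

lemma ends_ok_tree: "rooted_tree g \<Longrightarrow> ends_ok g"
  using rooted_tree_edges_sub[of g] by (auto simp: ends_ok_def rooted_tree_def)

lemma ends_ok_iso: assumes "ends_ok g" "rg_iso g h" shows "ends_ok h"
proof -
  obtain f where "verts h = f ` verts g" "edges h = (\<lambda>e. f ` e) ` edges g" "root h = f (root g)"
    using assms(2) by (auto simp: rg_iso_def iso_via_def bij_betw_def)
  then show ?thesis using assms(1) by (simp add: ends_ok_def image_mono)
qed

lemma rg_iso_sym': "ends_ok g \<Longrightarrow> rg_iso g h \<Longrightarrow> rg_iso h g"
  using rg_iso_sym[of g h] by (auto simp: ends_ok_def)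

lemma rg_iso_cong:
  assumes "ends_ok g" "ends_ok h" "rg_iso g g'" "rg_iso h h'"
  shows "rg_iso g h \<longleftrightarrow> rg_iso g' h'"
proof
  assume "rg_iso g h"
  then show "rg_iso g' h'"
    using rg_iso_trans[OF rg_iso_sym'[OF assms(1,3)]] rg_iso_trans[OF _ assms(4)] by blast
next
  assume "rg_iso g' h'"
  then show "rg_iso g h"
    using rg_iso_trans[OF assms(3)] rg_iso_trans[OF _ rg_iso_sym'[OF assms(2,4)]] by blast
qed

lemma ends_ok_R: "rooted_tree g \<Longrightarrow> ends_ok (tree_R g e)"
  by (auto simp: ends_ok_def tree_R_def root_part_def rooted_tree_def)

lemma ends_ok_P: assumes "rooted_tree g" "e \<in> edges g" shows "ends_ok (tree_P g e)"
proof -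
  have "iso_via id g g" by (simp add: iso_via_def)
  then have "root (tree_P g e) \<in> verts (tree_P g e)"
    using iso_tree_P(2) assms by blast
  then show ?thesis by (simp add: ends_ok_def tree_P_def Let_def)
qed

lemma ends_ok_join: "ends_ok s \<Longrightarrow> ends_ok t \<Longrightarrow> v \<in> verts s \<Longrightarrow> ends_ok (tree_join s v t)"
  by (auto simp: ends_ok_def tree_join_def)

subsection \<open>Isomorphism classes\<close>

definition rtree_rel :: "nat rgraph \<Rightarrow> nat rgraph \<Rightarrow> bool" where
  "rtree_rel g h \<longleftrightarrow> rooted_tree g \<and> rooted_tree h \<and> rg_iso g h"

lemma rooted_tree_single: "rooted_tree (RGraph {v} {} v)"
  by (auto simp: rooted_tree_def is_cycle_def intro: exI[of _ 0])

text \<open>Every finite graph is isomorphic to one with vertices in \<open>nat\<close>, so this type is the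
  set of isomorphism classes of all finite rooted trees.\<close>

quotient_type rtree = "nat rgraph" / partial: rtree_rel
proof (rule part_equivpI)
  show "\<exists>g. rtree_rel g g"
    unfolding rtree_rel_def
    by (rule exI[of _ "RGraph {0} {} 0"]) (simp add: rooted_tree_single rg_iso_refl)
  show "symp rtree_rel"
    unfolding rtree_rel_def using rg_iso_sym'[OF ends_ok_tree] by (intro sympI) blast
  show "transp rtree_rel"
  proof (rule transpI)
    fix g h k assume "rtree_rel g h" "rtree_rel h k"
    then show "rtree_rel g k" unfolding rtree_rel_def using rg_iso_trans[of g h k] by simp
  qed
qed

lift_definition tsize :: "rtree \<Rightarrow> nat" is "\<lambda>g. card (verts g)"
proof -
  fix g h assume "rtree_rel g h"
  then obtain f where "bij_betw f (verts g) (verts h)"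
    unfolding rtree_rel_def rg_iso_def iso_via_def by blast
  then show "card (verts g) = card (verts h)" by (rule bij_betw_same_card)
qed

lemma card_filter_bij:
  assumes "bij_betw f A B" "\<And>x. x \<in> A \<Longrightarrow> P x \<longleftrightarrow> Q (f x)"
  shows "card {x \<in> A. P x} = card {y \<in> B. Q y}"
proof -
  have B: "B = f ` A" and i: "inj_on f A" using assms(1) by (simp_all add: bij_betw_def)
  have "{y \<in> B. Q y} = f ` {x \<in> A. P x}" unfolding B using assms(2) by auto
  moreover have "inj_on f {x \<in> A. P x}" by (rule inj_on_subset[OF i]) simp
  ultimately show ?thesis by (simp add: card_image)
qed

lift_definition alpha :: "rtree \<Rightarrow> rtree \<Rightarrow> rtree \<Rightarrow> nat" is
  "\<lambda>g1 g2 g3. card {e \<in> edges g2. rg_iso (tree_R g2 e) g3 \<and> rg_iso (tree_P g2 e) g1}"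
proof -
  fix g1 h1 g2 h2 g3 h3 :: "nat rgraph"
  assume r: "rtree_rel g1 h1" "rtree_rel g2 h2" "rtree_rel g3 h3"
  then obtain f where f: "iso_via f g2 h2" by (auto simp: rtree_rel_def rg_iso_def)
  let ?A = "\<lambda>g1 g2 g3 e. rg_iso (tree_R g2 e) g3 \<and> rg_iso (tree_P g2 e) g1"
  have t: "rooted_tree g2" "rooted_tree h2" "ends_ok g1" "ends_ok g3" "rg_iso g1 h1" "rg_iso g3 h3"
    using r by (auto simp: rtree_rel_def intro: ends_ok_tree)
  have A: "?A g1 g2 g3 e \<longleftrightarrow> ?A h1 h2 h3 (f ` e)" if e: "e \<in> edges g2" for e
  proof -
    have i: "rg_iso (tree_R g2 e) (tree_R h2 (f ` e))" "rg_iso (tree_P g2 e) (tree_P h2 (f ` e))"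
      using iso_tree_R[OF f t(1) e] iso_tree_P(1)[OF f t(1,2) e] by (auto simp: rg_iso_def)
    show ?thesis
      using rg_iso_cong[OF ends_ok_R[OF t(1)] t(4) i(1) t(6)]
        rg_iso_cong[OF ends_ok_P[OF t(1) e] t(3) i(2) t(5)] by simp
  qed
  have b: "bij_betw (\<lambda>e. f ` e) (edges g2) (edges h2)" by (rule iso_edge_bij[OF f t(1)])
  show "card {e \<in> edges g2. ?A g1 g2 g3 e} = card {e \<in> edges h2. ?A h1 h2 h3 e}"
    by (rule card_filter_bij[OF b]) (rule A)
qed

lift_definition beta :: "rtree \<Rightarrow> rtree \<Rightarrow> rtree \<Rightarrow> nat" is
  "\<lambda>g1 g2 g3. card {v \<in> verts g3. rg_iso g1 (tree_join g3 v g2)}"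
proof -
  fix g1 h1 g2 h2 g3 h3 :: "nat rgraph"
  assume r: "rtree_rel g1 h1" "rtree_rel g2 h2" "rtree_rel g3 h3"
  then obtain f k where f: "iso_via f g3 h3" and k: "iso_via k g2 h2"
    by (auto simp: rtree_rel_def rg_iso_def)
  have t: "ends_ok g1" "ends_ok g2" "ends_ok g3" "rg_iso g1 h1"
    using r by (auto simp: rtree_rel_def intro: ends_ok_tree)
  have A: "rg_iso g1 (tree_join g3 v g2) \<longleftrightarrow> rg_iso h1 (tree_join h3 (f v) h2)" if "v \<in> verts g3" for v
    using that t iso_tree_join[OF f k, of v]
    by (intro rg_iso_cong ends_ok_join) (auto simp: rg_iso_def)
  have b: "bij_betw f (verts g3) (verts h3)" using f by (simp add: iso_via_def)
  show "card {v \<in> verts g3. rg_iso g1 (tree_join g3 v g2)} =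
      card {v \<in> verts h3. rg_iso h1 (tree_join h3 v h2)}"
    by (rule card_filter_bij[OF b]) (rule A)
qed

section \<open>Lie algebras\<close>

locale lie_algebra = vector_space scale
  for scale :: "'k::field \<Rightarrow> 'a::ab_group_add \<Rightarrow> 'a" +
  fixes bracket :: "'a \<Rightarrow> 'a \<Rightarrow> 'a"
  assumes bracket_linear_left: "Vector_Spaces.linear scale scale (\<lambda>x. bracket x y)"
    and bracket_linear_right: "Vector_Spaces.linear scale scale (\<lambda>y. bracket x y)"
    and bracket_self: "bracket x x = 0"
    and jacobi: "bracket x (bracket y z) + bracket y (bracket z x) + bracket z (bracket x y) = 0"
begin

definition lie_subalgebra :: "'a set \<Rightarrow> bool" where
  "lie_subalgebra S \<longleftrightarrow> subspace S \<and> (\<forall>x \<in> S. \<forall>y \<in> S. bracket x y \<in> S)"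

definition finitely_generated :: bool where
  "finitely_generated \<longleftrightarrow> (\<exists>X. finite X \<and> lie_subalgebra hull X = UNIV)"

end

datatype gen = Gd | Gp rtree | Gm rtree

text \<open>\<open>D Gd\<close>, \<open>D (Gp t)\<close>, \<open>D (Gm t)\<close> are \<open>d\<close>, \<open>D\<^sub>t\<^sup>+\<close>, \<open>D\<^sub>t\<^sup>-\<close>; they form a basis of the Lie
  algebra, whose carrier is the whole type \<open>'a\<close>. All sums over trees have finite support:
  given two of the arguments of \<open>alpha\<close> or \<open>beta\<close> below, only finitely many values
  of the third give a nonzero count.\<close>

locale insertion_elimination_algebra = lie_algebra scale bracket
  for scale :: "complex \<Rightarrow> 'a::ab_group_add \<Rightarrow> 'a"
    and bracket :: "'a \<Rightarrow> 'a \<Rightarrow> 'a" +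
  fixes D :: "gen \<Rightarrow> 'a"
  assumes inj_D: "inj D"
    and independent_D: "independent (range D)"
    and span_D: "span (range D) = UNIV"
    and plus_plus: "bracket (D (Gp s)) (D (Gp t)) =
      Sum_any (\<lambda>r. scale (of_nat (beta r s t) - of_nat (beta r t s)) (D (Gp r)))"
    and minus_minus: "bracket (D (Gm s)) (D (Gm t)) =
      Sum_any (\<lambda>r. scale (of_nat (alpha t r s) - of_nat (alpha s r t)) (D (Gm r)))"
    and minus_plus: "s \<noteq> t \<Longrightarrow> bracket (D (Gm s)) (D (Gp t)) =
      Sum_any (\<lambda>r. scale (of_nat (alpha s t r)) (D (Gp r))) + Sum_any (\<lambda>r. scale (of_nat (beta s t r)) (D (Gm r)))"
    and minus_plus_same: "bracket (D (Gm t)) (D (Gp t)) = D Gd"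
    and d_minus: "bracket (D Gd) (D (Gm t)) = scale (- of_nat (tsize t)) (D (Gm t))"
    and d_plus: "bracket (D Gd) (D (Gp t)) = scale (of_nat (tsize t)) (D (Gp t))"

end

theory Submission
  imports Defs
begin

text \<open>
  A finite subset of the algebra involves only basis elements \<open>d\<close>, \<open>D\<^sub>t\<^sup>+\<close>, \<open>D\<^sub>t\<^sup>-\<close> with
  \<open>|t| \<le> N\<close> for some \<open>N\<close>; call these the small generators. It suffices to find, for every \<open>N\<close>, a
  proper subspace that contains the small generators and that every small generator maps into
  itself: the elements of such a subspace \<open>T\<close> that bracket \<open>T\<close> into \<open>T\<close> form a Lie subalgebra
  (\<open>lie_subalgebra_stabilizer\<close>), which then contains the subalgebra generated by the finite set.

  Let \<open>W\<close> be spanned by the right-normed words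
  \<open>[D\<^sup>+\<^sub>a, [D\<^sup>+\<^sub>b, \<dots>, [D\<^sup>+\<^sub>y, D\<^sup>+\<^sub>z]]]\<close> in trees with at most \<open>N\<close> vertices, and let
  \<open>T\<close> be the span of all \<open>D\<^sub>t\<^sup>-\<close>, of \<open>d\<close> and of \<open>W\<close>. Only one stability property is not
  immediate: \<open>D\<^sub>s\<^sup>-\<close> with \<open>|s| \<le> N\<close> maps \<open>W\<close> into \<open>T\<close>. By the Jacobi identity
  \<open>[D\<^sub>s\<^sup>-, [D\<^sub>t\<^sup>+, w]] = [[D\<^sub>s\<^sup>-, D\<^sub>t\<^sup>+], w] + [D\<^sub>t\<^sup>+, [D\<^sub>s\<^sup>-, w]]\<close>, and
  \<open>[D\<^sub>s\<^sup>-, D\<^sub>t\<^sup>+]\<close> is again a combination of small generators, since its terms are obtained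
  from \<open>s\<close> and \<open>t\<close> by removing vertices, or are \<open>d\<close>. Induction on the length of the word works because
  \<open>[D\<^sub>s\<^sup>-, w]\<close> stays in the span of \<open>d\<close>, \<open>W\<close> and the \<^emph>\<open>small\<close> \<open>D\<^sub>r\<^sup>-\<close>, which
  \<open>D\<^sub>t\<^sup>+\<close> preserves (\<open>bracket_minus_word\<close>).

  The subspace \<open>T\<close> is proper because of ladders, the rooted trees that are paths starting at the
  root. Joining \<open>s\<close> to \<open>t\<close> at a vertex gives a ladder exactly if both are ladders and the vertex is
  the leaf of \<open>t\<close>. This condition is symmetric in \<open>s\<close> and \<open>t\<close>, so for a ladder \<open>L\<close> the coefficient
  \<open>\<beta>(L,s,t) - \<beta>(L,t,s)\<close> of \<open>D\<^sub>L\<^sup>+\<close> in \<open>[D\<^sub>s\<^sup>+, D\<^sub>t\<^sup>+]\<close> vanishes (\<open>beta_ladder_sym\<close>). If \<open>L\<close> has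
  \<open>N + 1\<close> vertices, it is not a word of length one either, hence \<open>D\<^sub>L\<^sup>+\<close> is not in \<open>T\<close>
  (\<open>ladder_notin_large_part\<close>).
\<close>

section \<open>Ladder graphs\<close>

definition ladder :: "nat \<Rightarrow> nat rgraph" where
  "ladder n = RGraph {..<n} ((\<lambda>i. {i, Suc i}) ` {i. Suc i < n}) 0"

lemma rooted_tree_ladder: "rooted_tree (ladder (Suc n))"
proof -
  let ?E = "edges (ladder (Suc n))"
  have E: "{u, v} \<in> ?E \<longleftrightarrow> (v = Suc u \<or> u = Suc v) \<and> u \<le> n \<and> v \<le> n" for u v
    by (auto simp: ladder_def doubleton_eq_iff)
  have up: "(0, v) \<in> (adj ?E)\<^sup>*" if "v \<le> n" for v
    using that
  proof (induction v)
    case (Suc v)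
    then have "(v, Suc v) \<in> adj ?E" by (simp add: adj_def E)
    then show ?case using Suc by (auto intro: rtrancl_into_rtrancl)
  qed simp
  have sym: "sym ((adj ?E)\<^sup>*)"
    by (intro sym_rtrancl) (auto simp: sym_def adj_def insert_commute)
  have conn: "(u, v) \<in> (adj ?E)\<^sup>*" if "u \<le> n" "v \<le> n" for u v
    using up[OF that(1)] up[OF that(2)] sym by (meson rtrancl_trans symD)
  have acyc: "\<not> is_cycle ?E xs" for xs
  proof
    assume "is_cycle ?E xs"
    then have len: "length xs \<ge> 3" and dist: "distinct xs"
      and ed: "\<And>i. i < length xs \<Longrightarrow> {xs ! i, xs ! (Suc i mod length xs)} \<in> ?E"
      by (auto simp: is_cycle_def)
    let ?k = "length xs"
    have "Max (set xs) \<in> set xs" using len by (intro Max_in) auto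
    then obtain i where i: "i < ?k" "xs ! i = Max (set xs)" by (auto simp: in_set_conv_nth)
    \<comment> \<open>both neighbours of the largest vertex on the cycle would be its predecessor\<close>
    have le: "xs ! j \<le> xs ! i" if "j < ?k" for j
      using that i(2) by simp
    define a where "a = Suc i mod ?k"
    define b where "b = (if i = 0 then ?k - 1 else i - 1)"
    have ab: "a < ?k" "b < ?k" using i(1) len by (auto simp: a_def b_def intro!: mod_less_divisor)
    have "Suc b mod ?k = i" using i(1) len by (auto simp: b_def)
    then have "{xs ! b, xs ! i} \<in> ?E" using ed[OF ab(2)] by simp
    then have 1: "xs ! i = Suc (xs ! b)" using le[OF ab(2)] by (auto simp: E)
    have "{xs ! i, xs ! a} \<in> ?E" using ed[OF i(1)] by (simp add: a_def)
    then have 2: "xs ! i = Suc (xs ! a)" using le[OF ab(1)] by (auto simp: E)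
    have "a \<noteq> b" using i(1) len by (cases "Suc i = ?k") (auto simp: a_def b_def split: if_splits)
    moreover have "xs ! a = xs ! b" using 1 2 by simp
    ultimately show False using dist ab by (simp add: nth_eq_iff_index_eq)
  qed
  have 1: "\<exists>u v. u \<in> verts (ladder (Suc n)) \<and> v \<in> verts (ladder (Suc n)) \<and> u \<noteq> v \<and> e = {u, v}"
    if "e \<in> ?E" for e
  proof -
    from that obtain i where "i < n" "e = {i, Suc i}" by (auto simp: ladder_def)
    then show ?thesis by (intro exI[of _ i] exI[of _ "Suc i"]) (auto simp: ladder_def)
  qed
  have 2: "verts (ladder (Suc n)) = {..n}" "root (ladder (Suc n)) = 0"
    by (auto simp: ladder_def)
  show ?thesis
    unfolding rooted_tree_def using 1 conn acyc by (auto simp: 2)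
qed

text \<open>An isomorphism from a ladder is an enumeration of the vertices along a path from the root,
  the form in which ladders are recognised below.\<close>

lemma iso_via_ladder_iff:
  "iso_via f (ladder n) g \<longleftrightarrow> bij_betw f {..<n} (verts g) \<and>
     (\<forall>e. e \<in> edges g \<longleftrightarrow> (\<exists>i. Suc i < n \<and> e = {f i, f (Suc i)})) \<and> root g = f 0"
proof -
  have "(\<lambda>e. f ` e) ` edges (ladder n) = {e. \<exists>i. Suc i < n \<and> e = {f i, f (Suc i)}}"
    by (auto simp: ladder_def image_image)
  then show ?thesis by (simp add: iso_via_def set_eq_iff) (simp add: ladder_def)
qed

text \<open>Ladders are rigid: each step of the enumeration is the only edge that does not lead back.
  Hence the joining vertex of a ladder is determined, and the counts \<open>\<beta>\<close> below are at most 1.\<close>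

lemma iso_via_ladder_unique:
  assumes p: "iso_via p (ladder n) g" and q: "iso_via q (ladder n) g" and "i < n"
  shows "q i = p i"
  using \<open>i < n\<close>
proof (induction i rule: less_induct)
  case (less k)
  show ?case
  proof (cases k)
    case 0
    then show ?thesis using p q by (simp add: iso_via_ladder_iff)
  next
    case (Suc i)
    have ip: "inj_on p {..<n}" and iq: "inj_on q {..<n}"
      using p q by (simp_all add: iso_via_ladder_iff bij_betw_def)
    have "{q i, q k} \<in> edges g" using q less.prems Suc by (auto simp: iso_via_ladder_iff)
    then obtain j where j: "Suc j < n" "{q i, q k} = {p j, p (Suc j)}"
      using p by (auto simp: iso_via_ladder_iff)
    have qi: "q i = p i" using less Suc by simp
    consider "p i = p j" "q k = p (Suc j)" | "p i = p (Suc j)" "q k = p j"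
      using j(2) qi by (auto simp: doubleton_eq_iff)
    then show ?thesis
    proof cases
      case 1
      then have "i = j" using inj_onD[OF ip] j(1) less.prems Suc by simp
      then show ?thesis using 1 Suc by simp
    next
      case 2
      then have ij: "i = Suc j" using inj_onD[OF ip 2(1)] j(1) less.prems Suc by simp
      then have "q k = q j" using 2 less Suc by simp
      then have "k = j" using inj_onD[OF iq] j(1) less.prems by simp
      then show ?thesis using ij Suc by simp
    qed
  qed
qed

section \<open>Joins that are ladders\<close>

lemma tree_join_edges_cases:
  assumes "e \<in> edges (tree_join t v s)"
  obtains x where "x \<in> edges t" "e = Inl ` x" | y where "y \<in> edges s" "e = Inr ` y"
    | "e = {Inl v, Inr (root s)}"
  using assms by (auto simp: tree_join_def)

lemma Inl_image_edge_iff: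
  assumes "e \<noteq> {}"
  shows "Inl ` e \<in> edges (tree_join t v s) \<longleftrightarrow> e \<in> edges t"
proof
  assume "Inl ` e \<in> edges (tree_join t v s)"
  then show "e \<in> edges t"
  proof (cases rule: tree_join_edges_cases)
    case (1 x)
    then show ?thesis by (simp add: inj_image_eq_iff)
  next
    case (2 y)
    then show ?thesis using assms by blast
  next
    case 3
    then show ?thesis by blast
  qed
qed (simp add: tree_join_def)

lemma Inr_image_edge_iff:
  assumes "e \<noteq> {}"
  shows "Inr ` e \<in> edges (tree_join t v s) \<longleftrightarrow> e \<in> edges s"
proof
  assume "Inr ` e \<in> edges (tree_join t v s)"
  then show "e \<in> edges s"
  proof (cases rule: tree_join_edges_cases)
    case (2 x)
    then show ?thesis by (simp add: inj_image_eq_iff)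
  next
    case (1 y)
    then show ?thesis using assms by blast
  next
    case 3
    then show ?thesis by blast
  qed
qed (simp add: tree_join_def)

text \<open>Only one edge of the join connects its two halves, so a path that starts in the first half
  changes sides exactly once: an initial segment enumerates \<open>t\<close> and the rest enumerates \<open>s\<close>.\<close>

lemma ladder_join_split:
  fixes t :: "'a rgraph" and s :: "'b rgraph"
  assumes f: "iso_via f (ladder n) (tree_join t v s)"
  obtains p q where "iso_via p (ladder (card (verts t))) t" "iso_via q (ladder (card (verts s))) s"
    "v = p (card (verts t) - 1)" "card (verts t) + card (verts s) = n"
proof -
  let ?J = "tree_join t v s"
  have bij: "bij_betw f {..<n} (verts t <+> verts s)" and f0: "f 0 = Inl (root t)"
    and E: "\<And>e. e \<in> edges ?J \<longleftrightarrow> (\<exists>i. Suc i < n \<and> e = {f i, f (Suc i)})"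
    using f by (simp_all add: iso_via_ladder_iff tree_join_def)
  have inj: "inj_on f {..<n}" and img: "f ` {..<n} = verts t <+> verts s"
    using bij by (simp_all add: bij_betw_def)
  have "{Inl v, Inr (root s)} \<in> edges ?J" by (simp add: tree_join_def)
  \<comment> \<open>the path crosses the joining edge between positions \<open>c\<close> and \<open>c + 1\<close>\<close>
  then obtain c where c: "Suc c < n" "{f c, f (Suc c)} = {Inl v, Inr (root s)}"
    unfolding E by metis
  have same: "isl (f (Suc i)) = isl (f i)" if "Suc i < n" "i \<noteq> c" for i
  proof -
    have "{f i, f (Suc i)} \<in> edges ?J" using E that by blast
    then show ?thesis
    proof (cases rule: tree_join_edges_cases)
      case (1 x)
      then have "f i \<in> range Inl" "f (Suc i) \<in> range Inl" by blast+
      then show ?thesis by auto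
    next
      case (2 y)
      then have "f i \<in> range Inr" "f (Suc i) \<in> range Inr" by blast+
      then show ?thesis by auto
    next
      case 3
      then have "f ` {i, Suc i} = f ` {c, Suc c}" using c by simp
      then have "{i, Suc i} = {c, Suc c}"
        using inj_on_image_eq_iff[OF inj, of "{i, Suc i}" "{c, Suc c}"] that c by simp
      then show ?thesis using that by (auto simp: doubleton_eq_iff)
    qed
  qed
  have left: "isl (f i)" if "i \<le> c" for i
    using that
  proof (induction i)
    case (Suc i)
    then show ?case using same[of i] c by simp
  qed (simp add: f0)
  have fc: "f c = Inl v" "f (Suc c) = Inr (root s)"
    using c(2) left[of c] by (auto simp: doubleton_eq_iff)
  have right: "\<not> isl (f (Suc c + i))" if "Suc c + i < n" for i
    using that
  proof (induction i)
    case (Suc i)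
    then show ?case using same[of "Suc c + i"] by simp
  qed (simp add: fc)
  define p where "p i = projl (f i)" for i
  define q where "q i = projr (f (Suc c + i))" for i
  define k where "k = n - Suc c"
  have n: "n = Suc c + k" using c by (simp add: k_def)
  have fp: "f i = Inl (p i)" if "i < Suc c" for i
    using left[of i] that by (simp add: p_def)
  have fq: "f (Suc c + i) = Inr (q i)" if "i < k" for i
    using right[of i] that n by (simp add: q_def)
  have split: "i < Suc c \<or> (\<exists>j<k. i = Suc c + j)" if "i < n" for i
    using that n by (cases "i < Suc c") (auto intro!: exI[of _ "i - Suc c"])
  have p: "bij_betw p {..<Suc c} (verts t)"
  proof (rule bij_betw_imageI)
    show "inj_on p {..<Suc c}"
    proof (rule inj_onI)
      fix x y assume xy: "x \<in> {..<Suc c}" "y \<in> {..<Suc c}" "p x = p y"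
      then have "f x = f y" using fp by simp
      then show "x = y" using inj_onD[OF inj, of x y] xy c(1) by simp
    qed
    show "p ` {..<Suc c} = verts t"
    proof (intro equalityI subsetI)
      fix a assume "a \<in> p ` {..<Suc c}"
      then obtain i where i: "i < Suc c" "a = p i" by auto
      then have "Inl a \<in> f ` {..<n}" using fp[of i] c(1) by (intro image_eqI[of _ _ i]) auto
      then show "a \<in> verts t" using img by auto
    next
      fix a assume "a \<in> verts t"
      then have "Inl a \<in> f ` {..<n}" by (simp add: img InlI)
      then obtain i where i: "i < n" "f i = Inl a" by auto
      then show "a \<in> p ` {..<Suc c}" using split[OF i(1)] fp[of i] fq by auto
    qed
  qed
  have q: "bij_betw q {..<k} (verts s)"
  proof (rule bij_betw_imageI)
    show "inj_on q {..<k}"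
    proof (rule inj_onI)
      fix x y assume xy: "x \<in> {..<k}" "y \<in> {..<k}" "q x = q y"
      then have "f (Suc c + x) = f (Suc c + y)" using fq by simp
      then show "x = y" using inj_onD[OF inj, of "Suc c + x" "Suc c + y"] xy n by simp
    qed
    show "q ` {..<k} = verts s"
    proof (intro equalityI subsetI)
      fix a assume "a \<in> q ` {..<k}"
      then obtain i where i: "i < k" "a = q i" by auto
      then have "Inr a \<in> f ` {..<n}" using fq[of i] n by (intro image_eqI[of _ _ "Suc c + i"]) auto
      then show "a \<in> verts s" using img by auto
    next
      fix a assume "a \<in> verts s"
      then have "Inr a \<in> f ` {..<n}" by (simp add: img InrI)
      then obtain i where i: "i < n" "f i = Inr a" by auto
      then show "a \<in> q ` {..<k}" using split[OF i(1)] fp[of i] fq by auto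
    qed
  qed
  have card: "card (verts t) = Suc c" "card (verts s) = k"
    using bij_betw_same_card[OF p] bij_betw_same_card[OF q] by simp_all
  have Et: "e \<in> edges t \<longleftrightarrow> (\<exists>i. Suc i < Suc c \<and> e = {p i, p (Suc i)})" for e
  proof
    assume e: "e \<in> edges t"
    then have "Inl ` e \<in> edges ?J" by (simp add: tree_join_def)
    then obtain i where i: "Suc i < n" "Inl ` e = {f i, f (Suc i)}" using E by metis
    then have "f (Suc i) \<in> range Inl" by blast
    then have ic: "Suc i < Suc c" using split[OF i(1)] fq by auto
    then have "(Inl ` e :: ('a + 'b) set) = Inl ` {p i, p (Suc i)}"
      using i fp[of i] fp[of "Suc i"] by simp
    then have "e = {p i, p (Suc i)}" by (simp only: inj_image_eq_iff[OF inj_Inl])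
    then show "\<exists>i. Suc i < Suc c \<and> e = {p i, p (Suc i)}" using ic by blast
  next
    assume "\<exists>i. Suc i < Suc c \<and> e = {p i, p (Suc i)}"
    then obtain i where i: "Suc i < Suc c" "e = {p i, p (Suc i)}" by blast
    then have "Inl ` e = {f i, f (Suc i)}" using fp[of i] fp[of "Suc i"] by simp
    then have "Inl ` e \<in> edges ?J" using E i c(1) by (metis Suc_lessD Suc_less_eq less_trans)
    then show "e \<in> edges t" using Inl_image_edge_iff[of e t v s] i(2) by blast
  qed
  have Es: "e \<in> edges s \<longleftrightarrow> (\<exists>i. Suc i < k \<and> e = {q i, q (Suc i)})" for e
  proof
    assume e: "e \<in> edges s"
    then have "Inr ` e \<in> edges ?J" by (simp add: tree_join_def)
    then obtain i where i: "Suc i < n" "Inr ` e = {f i, f (Suc i)}" using E by metis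
    then have "f i \<in> range Inr" by blast
    then obtain j where j: "j < k" "i = Suc c + j"
      using split[of i] fp i(1) by (metis Inl_Inr_False Suc_lessD rangeE)
    have jk: "Suc j < k" using i(1) j(2) n by simp
    then have "(Inr ` e :: ('a + 'b) set) = Inr ` {q j, q (Suc j)}"
      using i fq[of j] fq[of "Suc j"] j by simp
    then have "e = {q j, q (Suc j)}" by (simp only: inj_image_eq_iff[OF inj_Inr])
    then show "\<exists>i. Suc i < k \<and> e = {q i, q (Suc i)}" using jk by blast
  next
    assume "\<exists>i. Suc i < k \<and> e = {q i, q (Suc i)}"
    then obtain i where i: "Suc i < k" "e = {q i, q (Suc i)}" by blast
    then have "Inr ` e = {f (Suc c + i), f (Suc (Suc c + i))}" using fq[of i] fq[of "Suc i"] by simp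
    moreover have "Suc (Suc c + i) < n" using i n by simp
    ultimately have "Inr ` e \<in> edges ?J" using E by blast
    then show "e \<in> edges s" using Inr_image_edge_iff[of e t v s] i(2) by blast
  qed
  have "root t = p 0" "root s = q 0" "v = p c"
    using f0 fc by (simp_all add: p_def q_def)
  then show ?thesis
    using p q Et Es card n by (intro that[of p q]) (simp_all add: iso_via_ladder_iff)
qed

lemma ladder_join_glue:
  assumes p: "iso_via p (ladder m) t" and q: "iso_via q (ladder k) s" and "0 < m" "0 < k"
  shows "rg_iso (ladder (m + k)) (tree_join t (p (m - 1)) s)"
proof -
  define f where "f i = (if i < m then Inl (p i) else Inr (q (i - m)))" for i
  let ?J = "tree_join t (p (m - 1)) s"
  have p': "inj_on p {..<m}" "p ` {..<m} = verts t"
      "\<And>e. e \<in> edges t \<longleftrightarrow> (\<exists>i. Suc i < m \<and> e = {p i, p (Suc i)})" "root t = p 0"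
    and q': "inj_on q {..<k}" "q ` {..<k} = verts s"
      "\<And>e. e \<in> edges s \<longleftrightarrow> (\<exists>i. Suc i < k \<and> e = {q i, q (Suc i)})" "root s = q 0"
    using p q by (simp_all add: iso_via_ladder_iff bij_betw_def)
  have "inj_on f {..<m + k}"
    using inj_onD[OF p'(1)] inj_onD[OF q'(1)]
    by (intro inj_onI) (force simp: f_def split: if_splits)
  moreover have "f ` {..<m + k} = verts ?J"
  proof -
    have "{..<m + k} = {..<m} \<union> (\<lambda>i. m + i) ` {..<k}"
      using image_add_atLeastLessThan[of m 0 k] by (auto simp: lessThan_atLeast0 add.commute)
    then have "f ` {..<m + k} = f ` {..<m} \<union> (\<lambda>i. f (m + i)) ` {..<k}"
      by (simp add: image_Un image_image)
    also have "f ` {..<m} = Inl ` verts t"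
      unfolding p'(2)[symmetric] image_image by (intro image_cong) (auto simp: f_def)
    also have "(\<lambda>i. f (m + i)) ` {..<k} = Inr ` verts s"
      unfolding q'(2)[symmetric] image_image by (intro image_cong) (auto simp: f_def)
    finally show ?thesis by (simp add: tree_join_def Plus_def)
  qed
  moreover have "e \<in> edges ?J \<longleftrightarrow> (\<exists>i. Suc i < m + k \<and> e = {f i, f (Suc i)})" for e
  proof
    assume "e \<in> edges ?J"
    then show "\<exists>i. Suc i < m + k \<and> e = {f i, f (Suc i)}"
    proof (cases rule: tree_join_edges_cases)
      case (1 x)
      then obtain i where "Suc i < m" "x = {p i, p (Suc i)}" using p'(3) by blast
      then show ?thesis using 1 by (intro exI[of _ i]) (simp add: f_def)
    next
      case (2 y)
      then obtain i where "Suc i < k" "y = {q i, q (Suc i)}" using q'(3) by blast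
      then show ?thesis using 2 by (intro exI[of _ "m + i"]) (simp add: f_def Suc_diff_le)
    next
      case 3
      then show ?thesis using \<open>0 < m\<close> \<open>0 < k\<close> q'(4)
        by (intro exI[of _ "m - 1"]) (simp add: f_def)
    qed
  next
    assume "\<exists>i. Suc i < m + k \<and> e = {f i, f (Suc i)}"
    then obtain i where i: "Suc i < m + k" "e = {f i, f (Suc i)}" by blast
    consider "Suc i < m" | "Suc i = m" | "m \<le> i" by linarith
    then show "e \<in> edges ?J"
    proof cases
      case 1
      then have "e = Inl ` {p i, p (Suc i)}" using i by (simp add: f_def)
      moreover have "{p i, p (Suc i)} \<in> edges t" using 1 p'(3) by blast
      ultimately show ?thesis unfolding tree_join_def rgraph.sel by blast
    next
      case 2
      then show ?thesis using i q'(4) by (auto simp: tree_join_def f_def)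
    next
      case 3
      then have "e = Inr ` {q (i - m), q (Suc (i - m))}" using i by (simp add: f_def Suc_diff_le)
      moreover have "Suc (i - m) < k" using 3 i(1) by simp
      then have "{q (i - m), q (Suc (i - m))} \<in> edges s" using q'(3) by blast
      ultimately show ?thesis unfolding tree_join_def rgraph.sel by blast
    qed
  qed
  moreover have "root ?J = f 0" using \<open>0 < m\<close> p'(4) by (simp add: tree_join_def f_def)
  ultimately have "iso_via f (ladder (m + k)) ?J"
    by (simp add: iso_via_ladder_iff bij_betw_def)
  then show ?thesis by (auto simp: rg_iso_def)
qed

text \<open>The joining vertex has to be the leaf of \<open>t\<close>, so at most one vertex is counted. The point of
  the formula is that its right-hand side is symmetric in \<open>s\<close> and \<open>t\<close>.\<close>

lemma card_ladder_joins:
  assumes t: "rooted_tree t" and s: "rooted_tree s"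
  shows "card {v \<in> verts t. rg_iso (ladder n) (tree_join t v s)} =
    (if rg_iso (ladder (card (verts t))) t \<and> rg_iso (ladder (card (verts s))) s \<and>
        card (verts t) + card (verts s) = n then 1 else 0)"
    (is "card ?S = (if ?C then 1 else 0)")
proof (cases ?C)
  case True
  then obtain p q where p: "iso_via p (ladder (card (verts t))) t"
      and q: "iso_via q (ladder (card (verts s))) s" and n: "card (verts t) + card (verts s) = n"
    by (auto simp: rg_iso_def)
  have pos: "0 < card (verts t)" "0 < card (verts s)"
    using t s by (auto simp: rooted_tree_def card_gt_0_iff)
  have "?S = {p (card (verts t) - 1)}"
  proof (intro equalityI subsetI)
    fix v assume "v \<in> ?S"
    then obtain f where "iso_via f (ladder n) (tree_join t v s)" by (auto simp: rg_iso_def)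
    then obtain p' where "iso_via p' (ladder (card (verts t))) t" "v = p' (card (verts t) - 1)"
      by (rule ladder_join_split)
    then show "v \<in> {p (card (verts t) - 1)}" using iso_via_ladder_unique[OF p] pos by simp
  next
    fix v assume v: "v \<in> {p (card (verts t) - 1)}"
    have "p (card (verts t) - 1) \<in> p ` {..<card (verts t)}" using pos by simp
    then have "p (card (verts t) - 1) \<in> verts t" using p by (simp add: iso_via_ladder_iff bij_betw_def)
    then show "v \<in> ?S" using v ladder_join_glue[OF p q pos] n by simp
  qed
  then show ?thesis using True by simp
next
  case False
  have "?S = {}"
  proof (rule ccontr)
    assume "?S \<noteq> {}"
    then obtain v f where "iso_via f (ladder n) (tree_join t v s)" by (auto simp: rg_iso_def)
    then show False
      by (rule ladder_join_split) (use False in \<open>auto simp: rg_iso_def\<close>)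
  qed
  then show ?thesis unfolding if_not_P[OF False] by (simp only: card.empty)
qed

text \<open>The shift makes the index meaningful for every \<open>n\<close>, as a rooted tree is nonempty; so
  \<open>ladder_tree N\<close> is the smallest ladder with more than \<open>N\<close> vertices.\<close>

lift_definition ladder_tree :: "nat \<Rightarrow> rtree" is "\<lambda>n. ladder (Suc n)"
  by (simp add: rtree_rel_def rooted_tree_ladder rg_iso_refl)

lemma tsize_ladder_tree: "tsize (ladder_tree n) = Suc n"
  by transfer (simp add: ladder_def)

lemma beta_ladder_sym: "beta (ladder_tree n) s t = beta (ladder_tree n) t s"
  by transfer (auto simp: card_ladder_joins rtree_rel_def add.commute)

lemma beta_nonzero_size: "beta s t r \<noteq> 0 \<Longrightarrow> tsize s = tsize r + tsize t"
proof (transfer, goal_cases)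
  case (1 s t r)
  then obtain v where "rg_iso s (tree_join r v t)" by (auto simp: card_eq_0_iff)
  then obtain f where "bij_betw f (verts s) (verts r <+> verts t)"
    by (auto simp: rg_iso_def iso_via_def tree_join_def)
  then show ?case using bij_betw_same_card[of f] 1 
    by (simp add: card_Plus rtree_rel_def rooted_tree_def)
qed

lemma alpha_nonzero_size: "alpha s t r \<noteq> 0 \<Longrightarrow> tsize r \<le> tsize t"
proof (transfer, goal_cases)
  case (1 s t r)
  then obtain e where "rg_iso (tree_R t e) r" by (auto simp: card_eq_0_iff)
  then obtain f where "bij_betw f (root_part t e) (verts r)"
    by (auto simp: rg_iso_def iso_via_def tree_R_def)
  then have "card (verts r) = card (root_part t e)" by (simp add: bij_betw_same_card)
  also have "\<dots> \<le> card (verts t)" using 1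
    by (intro card_mono) (auto simp: rtree_rel_def rooted_tree_def root_part_def)
  finally show ?case .
qed

section \<open>Lie algebras and stable subspaces\<close>

context lie_algebra
begin

lemma module_hom_bracket_left: "module_hom scale scale (\<lambda>x. bracket x y)"
  using bracket_linear_left by (simp add: module_hom_iff_linear)

lemma module_hom_bracket_right: "module_hom scale scale (\<lambda>y. bracket x y)"
  using bracket_linear_right by (simp add: module_hom_iff_linear)

lemmas bracket_add_left = module_hom.add[OF module_hom_bracket_left]
lemmas bracket_add_right = module_hom.add[OF module_hom_bracket_right]
lemmas bracket_minus_right = module_hom.neg[OF module_hom_bracket_right]
lemmas bracket_scale_left = module_hom.scale[OF module_hom_bracket_left]
lemmas bracket_scale_right = module_hom.scale[OF module_hom_bracket_right]
lemmas subspace_bracket_left = module_hom.subspace_vimage[OF module_hom_bracket_left, unfolded vimage_def]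
lemmas subspace_bracket_right = module_hom.subspace_vimage[OF module_hom_bracket_right, unfolded vimage_def]

lemma bracket_swap: "bracket x y = - bracket y x"
proof -
  have "bracket (x + y) (x + y) = bracket x y + bracket y x"
    unfolding bracket_add_left bracket_add_right by (simp add: bracket_self)
  then show ?thesis using bracket_self by (metis eq_neg_iff_add_eq_0)
qed

text \<open>The Jacobi identity in the form in which every induction below uses it.\<close>

lemma bracket_derivation: "bracket x (bracket y z) = bracket (bracket x y) z + bracket y (bracket x z)"
proof -
  have "bracket x (bracket y z) + bracket y (bracket z x) + bracket z (bracket x y) = 0"
    by (rule jacobi)
  moreover have "bracket y (bracket z x) = - bracket y (bracket x z)"
    using bracket_swap[of z x] by (simp add: bracket_minus_right)
  moreover have "bracket z (bracket x y) = - bracket (bracket x y) z"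
    by (rule bracket_swap)
  ultimately show ?thesis by (simp add: algebra_simps)
qed

text \<open>The operators that preserve \<open>T\<close> are closed under commutators. The intersection with \<open>T\<close> is
  what bounds a generated subalgebra: to show that it lies in \<open>T\<close>, it suffices to check that the
  generators lie in \<open>T\<close> and preserve it.\<close>

lemma lie_subalgebra_stabilizer:
  assumes T: "subspace T"
  shows "lie_subalgebra {x \<in> T. \<forall>y \<in> T. bracket x y \<in> T}"
proof -
  let ?M = "{x \<in> T. \<forall>y \<in> T. bracket x y \<in> T}"
  have "?M = T \<inter> (\<Inter>y\<in>T. {x. bracket x y \<in> T})" by auto
  moreover have "subspace \<dots>"
    using T subspace_bracket_left[OF T] by (intro subspace_inter subspace_Inter) auto
  ultimately have "subspace ?M" by simp
  moreover have "bracket x y \<in> ?M" if x: "x \<in> ?M" and y: "y \<in> ?M" for x y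
  proof -
    have "bracket (bracket x y) z \<in> T" if z: "z \<in> T" for z
    proof -
      have "bracket (bracket x y) z = bracket x (bracket y z) - bracket y (bracket x z)"
        using bracket_derivation[of x y z] by (simp add: algebra_simps)
      then show ?thesis using x y z by (auto intro: subspace_diff[OF T])
    qed
    then show ?thesis using x y by simp
  qed
  ultimately show ?thesis by (simp add: lie_subalgebra_def)
qed

end

text \<open>The support may be infinite, in which case \<open>Sum_any\<close> is 0. So the structure equations of the
  algebra can be used without showing that their sums are finite.\<close>

lemma (in vector_space) subspace_Sum_any_scale:
  assumes S: "subspace S" and "\<And>r. c r \<noteq> 0 \<Longrightarrow> f r \<in> S"
  shows "Sum_any (\<lambda>r. scale (c r) (f r)) \<in> S"
  unfolding Sum_any.expand_set
proof (rule subspace_sum[OF S])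
  show "scale (c r) (f r) \<in> S" for r
    using assms subspace_0[OF S] by (cases "c r = 0") (auto intro: subspace_scale)
qed

section \<open>A proper subspace stable under the small generators\<close>

primrec gen_size :: "gen \<Rightarrow> nat" where
  "gen_size Gd = 0"
| "gen_size (Gp t) = tsize t"
| "gen_size (Gm t) = tsize t"

context insertion_elimination_algebra
begin

inductive_set plus_words :: "nat \<Rightarrow> 'a set" for N where
  letter: "tsize t \<le> N \<Longrightarrow> D (Gp t) \<in> plus_words N"
| Cons: "tsize t \<le> N \<Longrightarrow> w \<in> plus_words N \<Longrightarrow> bracket (D (Gp t)) w \<in> plus_words N"

text \<open>Two subspaces that differ only in the negative generators: \<open>small_part N\<close> receives
  \<open>[D\<^sub>s\<^sup>-, w]\<close> for a word \<open>w\<close>, \<open>large_part N\<close> is the subspace stable under all small generators.\<close>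

definition small_part :: "nat \<Rightarrow> 'a set" where
  "small_part N = span (insert (D Gd) ({D (Gm s) |s. tsize s \<le> N} \<union> plus_words N))"

definition large_part :: "nat \<Rightarrow> 'a set" where
  "large_part N = span (insert (D Gd) (range (\<lambda>s. D (Gm s)) \<union> plus_words N))"

lemma small_part_le: "small_part N \<subseteq> large_part N"
  unfolding small_part_def large_part_def by (rule span_mono) auto

text \<open>The terms of \<open>[D\<^sub>s\<^sup>-, D\<^sub>t\<^sup>+]\<close> are \<open>d\<close> if \<open>s = t\<close>, and otherwise the remainders of
  \<open>t\<close> after cutting off \<open>s\<close> and the remainders of \<open>s\<close> after removing a joined \<open>t\<close>. An arbitrary target \<open>S\<close> lets the
  lemma be applied to \<open>{x. [x, w] \<in> S}\<close> as well.\<close>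

lemma bracket_minus_plus_in:
  assumes S: "subspace S" "D Gd \<in> S"
    and p: "\<And>r. tsize r \<le> tsize t \<Longrightarrow> D (Gp r) \<in> S"
    and m: "\<And>r. tsize r \<le> tsize s \<Longrightarrow> D (Gm r) \<in> S"
  shows "bracket (D (Gm s)) (D (Gp t)) \<in> S"
proof (cases "s = t")
  case True
  then show ?thesis using S by (simp add: minus_plus_same)
next
  case False
  have "D (Gp r) \<in> S" if "of_nat (alpha s t r) \<noteq> (0::complex)" for r
    using that alpha_nonzero_size[of s t r] by (intro p) auto
  moreover have "D (Gm r) \<in> S" if "of_nat (beta s t r) \<noteq> (0::complex)" for r
    using that beta_nonzero_size[of s t r] by (intro m) auto
  ultimately show ?thesis
    unfolding minus_plus[OF False] by (intro subspace_add[OF S(1)] subspace_Sum_any_scale[OF S(1)])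
qed

text \<open>Words are homogeneous, and \<open>d\<close> acts on them by their degree.\<close>

lemma bracket_d_word:
  assumes "w \<in> plus_words N"
  shows "\<exists>c. bracket (D Gd) w = scale c w"
  using assms
proof induction
  case (letter t)
  then show ?case using d_plus by blast
next
  case (Cons t w)
  then obtain c where "bracket (D Gd) w = scale c w" by blast
  then have "bracket (D Gd) (bracket (D (Gp t)) w) = scale (of_nat (tsize t) + c) (bracket (D (Gp t)) w)"
    by (simp add: bracket_derivation[of "D Gd"] d_plus bracket_scale_left bracket_scale_right
        scale_left_distrib)
  then show ?case by blast
qed

lemma bracket_d_word_in: "w \<in> plus_words N \<Longrightarrow> subspace S \<Longrightarrow> w \<in> S \<Longrightarrow> bracket (D Gd) w \<in> S"
  using bracket_d_word[of w N] by (auto intro: subspace_scale)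

text \<open>Words need one more letter, and \<open>d\<close> and the \<open>D\<^sub>r\<^sup>-\<close> give small generators again. This
  handles the term \<open>[D\<^sub>t\<^sup>+, [D\<^sub>s\<^sup>-, w]]\<close> of the Jacobi identity.\<close>

lemma bracket_plus_small_part:
  assumes t: "tsize t \<le> N" and y: "y \<in> small_part N"
  shows "bracket (D (Gp t)) y \<in> small_part N"
proof -
  let ?S = "small_part N"
  have S: "subspace ?S" by (simp add: small_part_def)
  have in_S: "D Gd \<in> ?S" "\<And>r. tsize r \<le> N \<Longrightarrow> D (Gm r) \<in> ?S" "\<And>w. w \<in> plus_words N \<Longrightarrow> w \<in> ?S"
    by (auto simp: small_part_def intro!: span_base)
  have "bracket (D (Gp t)) (D Gd) \<in> ?S"
    unfolding bracket_swap[of _ "D Gd"] d_plus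
    by (intro subspace_neg[OF S] subspace_scale[OF S] in_S letter t)
  moreover have "bracket (D (Gp t)) (D (Gm r)) \<in> ?S" if r: "tsize r \<le> N" for r
  proof -
    have "bracket (D (Gm r)) (D (Gp t)) \<in> ?S"
      using r t by (intro bracket_minus_plus_in[OF S] in_S(1) in_S(2) in_S(3)[OF letter]) auto
    then show ?thesis unfolding bracket_swap[of "D (Gp t)"] by (rule subspace_neg[OF S])
  qed
  moreover have "bracket (D (Gp t)) w \<in> ?S" if "w \<in> plus_words N" for w
    by (rule in_S(3)[OF Cons[OF t that]])
  ultimately have "?S \<subseteq> {y. bracket (D (Gp t)) y \<in> ?S}"
    unfolding small_part_def[of N] using S
    by (intro span_minimal subspace_bracket_right) (auto simp: small_part_def)
  then show ?thesis using y by blast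
qed

text \<open>In the Jacobi expansion of \<open>[D\<^sub>s\<^sup>-, [D\<^sub>t\<^sup>+, w]]\<close> the terms of \<open>[D\<^sub>s\<^sup>-, D\<^sub>t\<^sup>+]\<close> act on the
  shorter word \<open>w\<close>: as letters, as \<open>d\<close>, or as \<open>D\<^sub>r\<^sup>-\<close> with \<open>|r| \<le> |s|\<close>. The last case is the
  induction hypothesis, which must therefore cover all \<open>s\<close> with \<open>|s| \<le> N\<close>.\<close>

lemma bracket_minus_word:
  assumes "w \<in> plus_words N" "tsize s \<le> N"
  shows "bracket (D (Gm s)) w \<in> small_part N"
  using assms
proof (induction arbitrary: s)
  let ?S = "small_part N"
  have S: "subspace ?S" by (simp add: small_part_def)
  have in_S: "D Gd \<in> ?S" "\<And>r. tsize r \<le> N \<Longrightarrow> D (Gm r) \<in> ?S" "\<And>w. w \<in> plus_words N \<Longrightarrow> w \<in> ?S"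
    by (auto simp: small_part_def intro!: span_base)
  {
    case (letter t)
    then show ?case by (intro bracket_minus_plus_in[OF S] in_S(1) in_S(2) in_S(3)[OF plus_words.letter]) auto
  next
    case (Cons t w)
    have "bracket (D (Gm s)) (D (Gp t)) \<in> {x. bracket x w \<in> ?S}"
    proof (rule bracket_minus_plus_in[OF subspace_bracket_left[OF S]])
      show "D Gd \<in> {x. bracket x w \<in> ?S}"
        using bracket_d_word_in[OF Cons.hyps(2) S] in_S(3)[OF Cons.hyps(2)] by simp
      show "D (Gp r) \<in> {x. bracket x w \<in> ?S}" if "tsize r \<le> tsize t" for r
        using that Cons.hyps in_S(3)[OF plus_words.Cons] by simp
      show "D (Gm r) \<in> {x. bracket x w \<in> ?S}" if "tsize r \<le> tsize s" for r
        using that Cons.prems Cons.IH by simp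
    qed
    moreover have "bracket (D (Gp t)) (bracket (D (Gm s)) w) \<in> ?S"
      using Cons by (intro bracket_plus_small_part)
    ultimately show ?case
      by (simp add: bracket_derivation[of "D (Gm s)"] subspace_add[OF S])
  }
qed

text \<open>Words of \<open>large_part N\<close> are taken care of by \<open>bracket_minus_word\<close>; the \<open>D\<^sub>r\<^sup>-\<close> of
  arbitrary size are harmless because \<open>[D\<^sub>t\<^sup>+, D\<^sub>r\<^sup>-]\<close> contains positive generators of size at
  most \<open>|t|\<close> only.\<close>

lemma large_part_stable:
  assumes g: "gen_size g \<le> N" and y: "y \<in> large_part N"
  shows "bracket (D g) y \<in> large_part N"
proof -
  let ?T = "large_part N"
  have T: "subspace ?T" by (simp add: large_part_def)
  have in_T: "D Gd \<in> ?T" "\<And>r. D (Gm r) \<in> ?T" "\<And>w. w \<in> plus_words N \<Longrightarrow> w \<in> ?T"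
    by (auto simp: large_part_def intro!: span_base)
  have mm: "bracket (D (Gm s)) (D (Gm r)) \<in> ?T" for s r
    unfolding minus_minus by (intro subspace_Sum_any_scale[OF T] in_T(2))
  have "bracket (D g) (D Gd) \<in> ?T"
  proof (cases g)
    case Gd
    then show ?thesis by (simp add: bracket_self subspace_0[OF T])
  next
    case (Gp t)
    have "D (Gp t) \<in> ?T" using g Gp by (intro in_T(3) letter) simp
    then show ?thesis unfolding Gp bracket_swap[of _ "D Gd"] d_plus
      by (intro subspace_neg[OF T] subspace_scale[OF T])
  next
    case (Gm t)
    then show ?thesis unfolding Gm bracket_swap[of _ "D Gd"] d_minus
      by (intro subspace_neg[OF T] subspace_scale[OF T] in_T(2))
  qed
  moreover have "bracket (D g) (D (Gm r)) \<in> ?T" for r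
  proof (cases g)
    case Gd
    then show ?thesis unfolding Gd d_minus by (intro subspace_scale[OF T] in_T(2))
  next
    case (Gp t)
    have "bracket (D (Gm r)) (D (Gp t)) \<in> ?T"
      using g Gp by (intro bracket_minus_plus_in[OF T] in_T(1) in_T(2) in_T(3)[OF letter]) auto
    then show ?thesis unfolding Gp bracket_swap[of "D (Gp t)"] by (rule subspace_neg[OF T])
  next
    case (Gm t)
    then show ?thesis using mm by simp
  qed
  moreover have "bracket (D g) w \<in> ?T" if w: "w \<in> plus_words N" for w
  proof (cases g)
    case Gd
    then show ?thesis using bracket_d_word_in[OF w T in_T(3)[OF w]] by simp
  next
    case (Gp t)
    then show ?thesis using g in_T(3)[OF Cons[OF _ w]] by simp
  next
    case (Gm t)
    then show ?thesis using g bracket_minus_word[OF w] small_part_le by auto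
  qed
  ultimately have "?T \<subseteq> {y. bracket (D g) y \<in> ?T}"
    unfolding large_part_def[of N] using T
    by (intro span_minimal subspace_bracket_right) (auto simp: large_part_def)
  then show ?thesis using y by blast
qed

lemma small_gen_in_large_part: "gen_size g \<le> N \<Longrightarrow> D g \<in> large_part N"
  by (cases g) (auto simp: large_part_def intro!: span_base letter)

section \<open>Ladders are not generated by smaller trees\<close>

text \<open>The coefficient of \<open>D\<^sub>L\<^sup>+\<close> for a ladder \<open>L\<close> is 0 by the symmetry of \<open>\<beta>(L,s,t)\<close> in \<open>s\<close>
  and \<open>t\<close>.\<close>

lemma bracket_avoids_ladder:
  "bracket (D (Gp s)) (D (Gp t)) \<in> span ((\<lambda>r. D (Gp r)) ` (- {ladder_tree n}))"
  unfolding plus_plus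
  by (intro subspace_Sum_any_scale subspace_span span_base) (auto simp: beta_ladder_sym)

lemma word_in_span_plus: "w \<in> plus_words N \<Longrightarrow> w \<in> span (range (\<lambda>r. D (Gp r)))"
proof (induction rule: plus_words.induct)
  case (letter t)
  show ?case by (intro span_base) auto
next
  case (Cons t w)
  let ?P = "span (range (\<lambda>r. D (Gp r)))"
  have "bracket (D (Gp t)) (D (Gp r)) \<in> ?P" for r
    unfolding plus_plus by (rule subspace_Sum_any_scale[OF subspace_span]) (simp add: span_base)
  then have "?P \<subseteq> {y. bracket (D (Gp t)) y \<in> ?P}"
    by (intro span_minimal subspace_bracket_right subspace_span) auto
  then show ?case using Cons by blast
qed

text \<open>A single letter is too small to be the ladder with \<open>N + 1\<close> vertices, and a longer word is a
  bracket of two elements of the positive part.\<close>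

lemma word_avoids_ladder:
  assumes "w \<in> plus_words N"
  shows "w \<in> span ((\<lambda>r. D (Gp r)) ` (- {ladder_tree N}))"
  using assms
proof cases
  case (letter t)
  then have "t \<noteq> ladder_tree N" by (auto simp: tsize_ladder_tree)
  then show ?thesis unfolding letter by (intro span_base) auto
next
  case (Cons t w')
  have "span (range (\<lambda>r. D (Gp r))) \<subseteq>
      {y. bracket (D (Gp t)) y \<in> span ((\<lambda>r. D (Gp r)) ` (- {ladder_tree N}))}"
    using bracket_avoids_ladder
    by (intro span_minimal subspace_bracket_right subspace_span) auto
  then show ?thesis using word_in_span_plus[OF Cons(3)] unfolding Cons(1) by blast
qed

lemma ladder_notin_large_part: "D (Gp (ladder_tree N)) \<notin> large_part N"
proof -
  let ?L = "D (Gp (ladder_tree N))"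
  have others: "D g \<in> span (range D - {?L})" if "g \<noteq> Gp (ladder_tree N)" for g
    using that inj_D by (intro span_base) (simp add: inj_eq)
  have "(\<lambda>r. D (Gp r)) ` (- {ladder_tree N}) \<subseteq> span (range D - {?L})"
    using others by auto
  then have "span ((\<lambda>r. D (Gp r)) ` (- {ladder_tree N})) \<subseteq> span (range D - {?L})"
    by (intro span_minimal subspace_span)
  then have "plus_words N \<subseteq> span (range D - {?L})"
    using word_avoids_ladder by (meson subset_eq)
  then have "large_part N \<subseteq> span (range D - {?L})"
    unfolding large_part_def using others by (intro span_minimal subspace_span) auto
  moreover have "?L \<notin> span (range D - {?L})"
    using independent_D rangeI[of D "Gp (ladder_tree N)"] unfolding dependent_def by (meson)
  ultimately show ?thesis by (meson subsetD)
qed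

lemma finite_in_span_small:
  assumes "finite X"
  shows "\<exists>N. X \<subseteq> span (D ` {g. gen_size g \<le> N})"
proof -
  have mono: "span (D ` {g. gen_size g \<le> M}) \<subseteq> span (D ` {g. gen_size g \<le> N})" if "M \<le> N" for M N
    using that by (intro span_mono) auto
  have one: "\<exists>N. x \<in> span (D ` {g. gen_size g \<le> N})" for x
  proof -
    have "x \<in> span (range D)" by (simp add: span_D)
    then show ?thesis
    proof (induction rule: span_induct_alt)
      case base
      show ?case by (simp add: span_zero)
    next
      case (step c a y)
      then obtain g N where g: "a = D g" and N: "y \<in> span (D ` {g. gen_size g \<le> N})" by auto
      have "a \<in> span (D ` {h. gen_size h \<le> max N (gen_size g)})"
        unfolding g by (intro span_base) auto
      moreover have "y \<in> span (D ` {h. gen_size h \<le> max N (gen_size g)})"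
        using N mono[of N "max N (gen_size g)"] by auto
      ultimately show ?case by (blast intro: span_add span_scale)
    qed
  qed
  show ?thesis
    using assms
  proof induction
    case (insert x X)
    then obtain M where M: "X \<subseteq> span (D ` {g. gen_size g \<le> M})" by blast
    obtain N where N: "x \<in> span (D ` {g. gen_size g \<le> N})" using one by blast
    show ?case
      using M N mono[of M "max M N"] mono[of N "max M N"] by (intro exI[of _ "max M N"]) auto
  qed simp
qed

lemma not_finitely_generated: "\<not> finitely_generated"
proof
  assume finitely_generated
  then obtain X where X: "finite X" "lie_subalgebra hull X = UNIV"
    by (auto simp: finitely_generated_def)
  then obtain N where N: "X \<subseteq> span (D ` {g. gen_size g \<le> N})"
    using finite_in_span_small by blast
  let ?T = "large_part N"
  let ?M = "{x \<in> ?T. \<forall>y \<in> ?T. bracket x y \<in> ?T}"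
  have M: "lie_subalgebra ?M"
    by (rule lie_subalgebra_stabilizer) (simp add: large_part_def)
  have "D ` {g. gen_size g \<le> N} \<subseteq> ?M"
    using small_gen_in_large_part large_part_stable by auto
  then have "span (D ` {g. gen_size g \<le> N}) \<subseteq> ?M"
    using M by (intro span_minimal) (auto simp: lie_subalgebra_def)
  then have "lie_subalgebra hull X \<subseteq> ?M" using N M by (intro hull_minimal) auto
  then have "D (Gp (ladder_tree N)) \<in> ?T" using X(2) by auto
  then show False using ladder_notin_large_part by blast
qed

end

theorem proposition8p7:
  fixes scale :: "complex \<Rightarrow> 'a::ab_group_add \<Rightarrow> 'a"
    and bracket :: "'a \<Rightarrow> 'a \<Rightarrow> 'a"
    and D :: "gen \<Rightarrow> 'a"
  assumes "insertion_elimination_algebra scale bracket D"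
  shows "\<not> lie_algebra.finitely_generated scale bracket"
  using assms by (rule insertion_elimination_algebra.not_finitely_generated)

end
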